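(* In the setting of the spectral-gauge cutting-plane method described in the context (with data $C$, $P_{\mathrm{lin}}$, $\mathcal{A}$, $T$, symmetric gauge $\phi$, norm $\|\cdot\|_{\mathcal{X}}$ on $\mathbb{S}^n$), assume that $\alpha_{\mathcal{X}}(\mathcal{A})<\infty$, and let the stopping tolerance be $\varepsilon>0$. Let $$d:=\dim(\mathbb{S}^n)=\frac{n(n+1)}{2},\qquad N^\varepsilon_{\mathcal{X}}(\mathcal{A},\phi):=1+\left\lceil\left(1+\frac{2\,\alpha_{\mathcal{X}}(\mathcal{A})\,T\,L_{\mathcal{X}}(\phi)\,\phi(e_1)}{\varepsilon}\right)^d\right\rceil,$$ where $e_1$ is any canonical basis vector of $\mathbb{R}^n$. Then there exists $i\in\{1,\dots,N^\varepsilon_{\mathcal{X}}(\mathcal{A},\phi)\}$ such that $\lambda_{\min}(X^{(i)})>-\varepsilon$. Equivalently, the method terminates, with stopping tolerance $\varepsilon>0$, after at most $N^\varepsilon_{\mathcal{X}}(\mathcal{A},\phi)$ iterations.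
   Context: $\mathbb{S}^n$ is the space of real symmetric $n\times n$ matrices with the Frobenius inner product $\langle A,B\rangle=\operatorname{tr}(A^\top B)$; $\mathbb{S}^n_+$ is the cone of positive semidefinite matrices. For $X\in\mathbb{S}^n$, $\lambda(X)\in\mathbb{R}^n$ is the vector of eigenvalues in nondecreasing order with multiplicity, $\lambda_{\min}(X)=\lambda_1(X)$, and $\lambda_-(X):=(\max\{-\lambda_i(X),0\})_i$. The support of a vector is the set of indices of its nonzero components. A symmetric gauge on $\mathbb{R}^n$ is a norm $\phi$ with $\phi(z)=\phi(|z|)$ (componentwise absolute value) and $\phi(Pz)=\phi(z)$ for every permutation matrix $P$ and all $z$. $\mathcal{B}_\phi:=\{S\in\mathbb{S}^n:\ \phi(\lambda(S))\le 1\}$. Problem: minimize $\langle C,X\rangle$ over $\mathcal{F}:=P_{\mathrm{lin}}\cap\mathbb{S}^n_+$, where $C\in\mathbb{S}^n$ and $P_{\mathrm{lin}}\subseteq\mathbb{S}^n$ is a polyhedron. Standing assumptions: $\mathcal{F}\neq\varnothing$; there is $T>0$ with $\operatorname{tr}(X)\le T$ for all $X\in\mathcal{F}$; $\mathcal{A}\subseteq\mathbb{S}^n$ is a closed convex cone with $\mathbb{S}^n_+\subseteq\mathcal{A}$ and $\operatorname{tr}(X)>0$ for every $X\in\mathcal{A}\setminus\{0\}$. Let $\mathcal{R}:=\{X\in\mathbb{S}^n:\ X\in P_{\mathrm{lin}},\ X\in\mathcal{A},\ \operatorname{tr}(X)\le T\}$. For an arbitrary norm $\|\cdot\|_{\mathcal{X}}$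 on $\mathbb{S}^n$, with dual norm $\|S\|^\circ_{\mathcal{X}}:=\max\{|\langle S,X\rangle|:\ X\in\mathbb{S}^n,\ \|X\|_{\mathcal{X}}\le 1\}$, define $$\alpha_{\mathcal{X}}(\mathcal{A}):=\sup\{\|X\|_{\mathcal{X}}:\ X\in\mathcal{A},\ \operatorname{tr}(X)=1\},\qquad L_{\mathcal{X}}(\phi):=\max_{S\in\mathbb{S}^n_+\cap\mathcal{B}_\phi}\|S\|^\circ_{\mathcal{X}}.$$ Spectral-gauge cutting-plane method with tolerance $\varepsilon\ge 0$: for $i=1,2,\dots$, let $X^{(i)}$ be an optimal solution of the master problem $\min\{\langle C,X\rangle:\ X\in\mathcal{R}^{(i)}\}$, where $\mathcal{R}^{(i)}:=\{X\in\mathcal{R}:\ \langle S^{(t)},X\rangle\ge 0,\ t=1,\dots,i-1\}$. Take an eigendecomposition $X^{(i)}=Q^{(i)}\operatorname{diag}(\lambda(X^{(i)}))(Q^{(i)})^\top$ with $Q^{(i)}$ orthogonal, choose $z^{(i)}\in\operatorname{argmax}\{\lambda_-(X^{(i)})^\top z:\ z\ge 0,\ \phi(z)\le 1,\ \operatorname{supp}(z)\subseteq\operatorname{supp}(\lambda_-(X^{(i)}))\}$, and set $S^{(i)}:=Q^{(i)}\operatorname{diag}(z^{(i)})(Q^{(i)})^\top$. If $\lambda_{\min}(X^{(i)})>-\varepsilon$, stop and return $X^{(i)}$; otherwise continue with $i+1$. *)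

theory Defs
  imports "HOL-Analysis.Analysis"
begin

section \<open>Symmetric matrices, eigenvalues\<close>

text \<open>
  The index type \<open>'n\<close> is finite and linearly ordered where the order of the eigenvalues matters;
  it plays the role of \<open>{1, \<dots>, n}\<close> with \<open>n = CARD('n) \<ge> 1\<close>. The inner product \<open>\<bullet>\<close> of the
  type \<open>real^'n^'n\<close> is the Frobenius inner product.
\<close>

type_synonym 'n rvec = "real^'n"
type_synonym 'n rmat = "real^'n^'n"

lemma frobenius_inner:
  fixes A B :: "real^'n^'n"
  shows "A \<bullet> B = trace (transpose A ** B)"
proof -
  have "A \<bullet> B = (\<Sum>i\<in>UNIV. \<Sum>j\<in>UNIV. A$i$j * B$i$j)"
    by (simp add: inner_vec_def)
  also have "\<dots> = (\<Sum>j\<in>UNIV. \<Sum>i\<in>UNIV. A$i$j * B$i$j)"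
    by (rule sum.swap)
  finally show ?thesis
    by (simp add: trace_def transpose_def matrix_matrix_mult_def)
qed

definition sym_mats :: "(real^'n^'n) set" where
  "sym_mats = {X. transpose X = X}"

definition psd_mats :: "(real^'n^'n) set" where
  "psd_mats = {X \<in> sym_mats. \<forall>x. 0 \<le> x \<bullet> (X *v x)}"

definition diag :: "real^'n \<Rightarrow> real^'n^'n" where
  "diag v = (\<chi> i j. if i = j then v$i else 0)"

text \<open>
  The eigenvalues with multiplicity are the roots of the characteristic polynomial
  \<open>t \<mapsto> det (t I - X)\<close>. For symmetric \<open>X\<close> it splits over the reals, so the vector below exists;
  uniqueness is shown in \<open>lambda_eqI\<close>.
\<close>
definition lambda :: "'n::{finite,linorder} rmat \<Rightarrow> 'n rvec" where
  "lambda X = (THE v. mono (\<lambda>i. v$i) \<and> (\<forall>t. det (mat t - X) = (\<Prod>i\<in>UNIV. t - v$i)))"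

definition lambda_min :: "'n::{finite,linorder} rmat \<Rightarrow> real" where
  "lambda_min X = lambda X $ Min UNIV"

definition lambda_neg :: "'n::{finite,linorder} rmat \<Rightarrow> 'n rvec" where
  "lambda_neg X = (\<chi> i. max (- lambda X $ i) 0)"

definition supp :: "real^'n \<Rightarrow> 'n set" where
  "supp z = {i. z$i \<noteq> 0}"

lemma lambda_eqI:
  fixes X :: "'n::{finite,linorder} rmat"
  assumes mv: "mono (\<lambda>i. v$i)" and v: "\<And>t. det (mat t - X) = (\<Prod>i\<in>UNIV. t - v$i)"
  shows "lambda X = v"
  unfolding lambda_def
proof (rule the_equality)
  show "mono (\<lambda>i. v$i) \<and> (\<forall>t. det (mat t - X) = (\<Prod>i\<in>UNIV. t - v$i))"
    using assms by blast
next
  fix w :: "'n rvec"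
  assume w: "mono (\<lambda>i. w$i) \<and> (\<forall>t. det (mat t - X) = (\<Prod>i\<in>UNIV. t - w$i))"
  define p where "p = (\<lambda>u::'n rvec. \<Prod>i\<in>UNIV. [:- u$i, 1:])"
  have pp: "poly (p u) t = (\<Prod>i\<in>UNIV. t - u$i)" for u t
    by (simp add: p_def poly_prod)
  have "poly (p w) = poly (p v)"
    using w v by (auto simp: pp fun_eq_iff)
  hence eq: "p w = p v"
    by (simp add: poly_eq_poly_eq_iff)
  define l where "l = sorted_list_of_set (UNIV :: 'n set)"
  have l: "sorted l" "set l = UNIV" "distinct l"
    by (auto simp: l_def)
  have pr: "mset (map (\<lambda>i. u$i) l) = proots (p u)" for u
  proof -
    have "p u = (\<Prod>i\<leftarrow>l. [:- u$i, 1:])"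
      unfolding p_def using l by (simp add: prod.distinct_set_conv_list flip: l(2))
    moreover have "(\<Prod>i\<leftarrow>xs. [:- u$i, 1:]) \<noteq> 0 \<and>
        proots (\<Prod>i\<leftarrow>xs. [:- u$i, 1:]) = mset (map (\<lambda>i. u$i) xs)" for xs
    proof (induction xs)
      case (Cons a xs)
      have "[:- u$a, 1:] = [:- u$a, 1::real:]" by simp
      with Cons show ?case
        by (simp add: proots_mult del: mult_pCons_left)
    qed simp
    ultimately show ?thesis by simp
  qed
  have so: "sorted (map (\<lambda>i. u$i) l)" if "mono (\<lambda>i. u$i)" for u :: "'n rvec"
    using that l(1) by (simp add: sorted_map sorted_wrt_mono_rel[of _ "(\<le>)"] monoD)
  have "map (\<lambda>i. w$i) l = map (\<lambda>i. v$i) l"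
    using properties_for_sort[of "map (\<lambda>i. w$i) l" "map (\<lambda>i. v$i) l"] so[of w] so[of v] w mv
      pr eq sorted_sort_id by metis
  thus "w = v"
    using l(2) by (simp add: vec_eq_iff)
qed

lemma dim_sym_mats:
  "dim (sym_mats :: 'n::{finite,linorder} rmat set) = CARD('n) * (CARD('n) + 1) div 2"
proof -
  let ?I = "{(i::'n, j). i \<le> j}"
  define E :: "'n \<times> 'n \<Rightarrow> 'n rmat"
    where "E = (\<lambda>(i, j). \<chi> a b. if (a, b) = (i, j) \<or> (b, a) = (i, j) then 1 else 0)"
  have E: "E q $ a $ b = (if (a, b) = q \<or> (b, a) = q then 1 else 0)" for q a b
    by (cases q) (simp add: E_def)
  have orth: "E q \<bullet> E r = 0" if "q \<in> ?I" "r \<in> ?I" "q \<noteq> r" for q r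
  proof -
    have 0: "E q $ a $ b * E r $ a $ b = 0" for a b
      using that by (auto simp: E)
    show ?thesis by (simp only: inner_vec_def inner_real_def 0 sum.neutral_const)
  qed
  have nz: "E q \<noteq> 0" for q
    using E[of q "fst q" "snd q"] by auto
  have inj: "inj_on E ?I"
  proof (rule inj_onI, rule ccontr)
    fix q r assume "q \<in> ?I" "r \<in> ?I" "E q = E r" "q \<noteq> r"
    with orth[of q r] nz[of r] show False by simp
  qed
  have "independent (E ` ?I)"
    by (rule pairwise_orthogonal_independent)
      (use nz in \<open>auto simp: pairwise_def orthogonal_def intro!: orth\<close>)
  moreover have "E ` ?I \<subseteq> sym_mats"
    by (auto simp: sym_mats_def transpose_def vec_eq_iff E)
  moreover have "sym_mats \<subseteq> span (E ` ?I)"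
  proof
    fix X :: "'n rmat" assume X: "X \<in> sym_mats"
    have sym: "X $ a $ b = X $ b $ a" for a b
    proof -
      have "X $ a $ b = transpose X $ b $ a" by (simp add: transpose_def)
      with X show ?thesis by (simp add: sym_mats_def)
    qed
    have "X = (\<Sum>q\<in>?I. X $ fst q $ snd q *\<^sub>R E q)" (is "_ = ?S")
    proof -
      have "?S $ a $ b = X $ a $ b" for a b
      proof -
        have "?S $ a $ b = (\<Sum>q\<in>?I. if q = (min a b, max a b) then X $ a $ b else 0)"
          unfolding sum_component
        proof (rule sum.cong)
          fix q assume "q \<in> ?I"
          then obtain i j where q: "q = (i, j)" "i \<le> j" by auto
          hence "(a, b) = q \<or> (b, a) = q \<longleftrightarrow> q = (min a b, max a b)"
            by (cases "a \<le> b") (auto simp: min_def max_def)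
          moreover have "X $ fst q $ snd q = X $ a $ b" if "(a, b) = q \<or> (b, a) = q"
            using that sym[of a b] by auto
          ultimately show "(X $ fst q $ snd q *\<^sub>R E q) $ a $ b =
              (if q = (min a b, max a b) then X $ a $ b else 0)"
            by (auto simp: E)
        qed simp
        also have "\<dots> = X $ a $ b"
          by (subst sum.delta) (auto simp: min_def max_def)
        finally show ?thesis .
      qed
      thus ?thesis by (simp add: vec_eq_iff)
    qed
    also have "\<dots> \<in> span (E ` ?I)"
      by (intro span_sum span_scale span_base) auto
    finally show "X \<in> span (E ` ?I)" .
  qed
  ultimately have "dim (sym_mats :: 'n rmat set) = card ?I"
    using card_image[OF inj] by (intro dim_unique[of "E ` ?I"])
  moreover have "2 * card ?I = CARD('n) * (CARD('n) + 1)"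
  proof -
    let ?J = "{(i::'n, j). j \<le> i}"
    have "?J = prod.swap ` ?I" by auto
    hence "card ?J = card ?I" by (simp add: card_image)
    moreover have "?I \<union> ?J = UNIV" by auto
    moreover have "?I \<inter> ?J = (\<lambda>i. (i, i)) ` UNIV" by auto
    hence "card (?I \<inter> ?J) = CARD('n)" by (simp add: card_image inj_on_def)
    ultimately show ?thesis
      using card_Un_Int[of ?I ?J] by simp
  qed
  ultimately show ?thesis by simp
qed

section \<open>Norms and gauges\<close>

definition norm_on :: "'a::real_vector set \<Rightarrow> ('a \<Rightarrow> real) \<Rightarrow> bool" where
  "norm_on V N \<longleftrightarrow>
     (\<forall>x\<in>V. 0 \<le> N x) \<and> (\<forall>x\<in>V. N x = 0 \<longleftrightarrow> x = 0) \<and>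
     (\<forall>c. \<forall>x\<in>V. N (c *\<^sub>R x) = \<bar>c\<bar> * N x) \<and>
     (\<forall>x\<in>V. \<forall>y\<in>V. N (x + y) \<le> N x + N y)"

text \<open>The vector \<open>\<chi> i. z$(p i)\<close> is \<open>P z\<close> for the permutation matrix \<open>P\<close> of \<open>p\<close>.\<close>
definition symmetric_gauge :: "(real^'n \<Rightarrow> real) \<Rightarrow> bool" where
  "symmetric_gauge \<phi> \<longleftrightarrow>
     norm_on UNIV \<phi> \<and> (\<forall>z. \<phi> z = \<phi> (\<chi> i. \<bar>z$i\<bar>)) \<and>
     (\<forall>p z. p permutes UNIV \<longrightarrow> \<phi> (\<chi> i. z$(p i)) = \<phi> z)"

definition gauge_ball :: "('n::{finite,linorder} rvec \<Rightarrow> real) \<Rightarrow> 'n rmat set" where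
  "gauge_ball \<phi> = {S \<in> sym_mats. \<phi> (lambda S) \<le> 1}"

text \<open>
  The maxima defining the dual norm and \<open>L\<close> are taken of continuous functions over nonempty compact
  sets, so they are written as suprema in \<open>real\<close>. The supremum \<open>\<alpha>\<close> is taken in \<open>ereal\<close>, since its
  finiteness is a hypothesis. Throughout, \<open>N\<close> is a norm on \<open>sym_mats\<close>, and its values elsewhere
  are irrelevant.
\<close>
definition dual_norm :: "(real^'n^'n \<Rightarrow> real) \<Rightarrow> real^'n^'n \<Rightarrow> real" where
  "dual_norm N S = (SUP X\<in>{X \<in> sym_mats. N X \<le> 1}. \<bar>S \<bullet> X\<bar>)"

definition alpha :: "(real^'n^'n \<Rightarrow> real) \<Rightarrow> (real^'n^'n) set \<Rightarrow> ereal" where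
  "alpha N A = (SUP X\<in>{X \<in> A. trace X = 1}. ereal (N X))"

definition L_const ::
  "('n::{finite,linorder} rmat \<Rightarrow> real) \<Rightarrow> ('n rvec \<Rightarrow> real) \<Rightarrow> real" where
  "L_const N \<phi> = (SUP S\<in>psd_mats \<inter> gauge_ball \<phi>. dual_norm N S)"

text \<open>\<open>axis k 1\<close> is the canonical basis vector \<open>e\<^sub>k\<close>; any \<open>k\<close> may be used.\<close>
definition iteration_bound ::
  "('n::{finite,linorder} rmat \<Rightarrow> real) \<Rightarrow> 'n rmat set \<Rightarrow> ('n rvec \<Rightarrow> real) \<Rightarrow>
   real \<Rightarrow> real \<Rightarrow> 'n \<Rightarrow> nat" where
  "iteration_bound N A \<phi> T \<epsilon> k =
     1 + nat \<lceil>(1 + 2 * real_of_ereal (alpha N A) * T * L_const N \<phi> * \<phi> (axis k 1) / \<epsilon>)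
               ^ dim (sym_mats :: 'n rmat set)\<rceil>"

section \<open>The spectral-gauge cutting-plane method\<close>

definition relaxation :: "(real^'n^'n) set \<Rightarrow> (real^'n^'n) set \<Rightarrow> real \<Rightarrow> (real^'n^'n) set" where
  "relaxation P A T = {X \<in> sym_mats. X \<in> P \<and> X \<in> A \<and> trace X \<le> T}"

definition master_set ::
  "(real^'n^'n) set \<Rightarrow> (real^'n^'n) set \<Rightarrow> real \<Rightarrow> (nat \<Rightarrow> real^'n^'n) \<Rightarrow> nat \<Rightarrow> (real^'n^'n) set"
  where
  "master_set P A T S i = {X \<in> relaxation P A T. \<forall>t\<in>{1..<i}. 0 \<le> S t \<bullet> X}"

text \<open>The data produced in iteration \<open>i\<close> are admissible, given the cuts \<open>S 1, \<dots>, S (i - 1)\<close>.\<close>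
definition scp_iteration ::
  "'n::{finite,linorder} rmat \<Rightarrow> 'n rmat set \<Rightarrow> 'n rmat set \<Rightarrow> real \<Rightarrow>
   ('n rvec \<Rightarrow> real) \<Rightarrow> (nat \<Rightarrow> 'n rmat) \<Rightarrow> (nat \<Rightarrow> 'n rmat) \<Rightarrow>
   (nat \<Rightarrow> 'n rvec) \<Rightarrow> (nat \<Rightarrow> 'n rmat) \<Rightarrow> nat \<Rightarrow> bool" where
  "scp_iteration C P A T \<phi> X Q z S i \<longleftrightarrow>
     is_arg_min (\<lambda>Y. C \<bullet> Y) (\<lambda>Y. Y \<in> master_set P A T S i) (X i) \<and>
     orthogonal_matrix (Q i) \<and> X i = Q i ** diag (lambda (X i)) ** transpose (Q i) \<and>
     is_arg_max (\<lambda>y. lambda_neg (X i) \<bullet> y)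
       (\<lambda>y. (\<forall>j. 0 \<le> y$j) \<and> \<phi> y \<le> 1 \<and> supp y \<subseteq> supp (lambda_neg (X i))) (z i) \<and>
     S i = Q i ** diag (z i) ** transpose (Q i)"

text \<open>Iteration \<open>i\<close> is reached: no earlier iteration has met the stopping criterion.\<close>
definition scp_reached ::
  "real \<Rightarrow> (nat \<Rightarrow> 'n::{finite,linorder} rmat) \<Rightarrow> nat \<Rightarrow> bool" where
  "scp_reached \<epsilon> X i \<longleftrightarrow> (\<forall>j\<in>{1..<i}. \<not> lambda_min (X j) > - \<epsilon>)"

text \<open>
  A run of the method; since the method is nondeterministic it is a relation on sequences. After
  the stopping criterion has been met, the entries of the sequences are arbitrary.
\<close>
definition scp_run ::
  "'n::{finite,linorder} rmat \<Rightarrow> 'n rmat set \<Rightarrow> 'n rmat set \<Rightarrow> real \<Rightarrow>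
   ('n rvec \<Rightarrow> real) \<Rightarrow> real \<Rightarrow> (nat \<Rightarrow> 'n rmat) \<Rightarrow> (nat \<Rightarrow> 'n rmat) \<Rightarrow>
   (nat \<Rightarrow> 'n rvec) \<Rightarrow> (nat \<Rightarrow> 'n rmat) \<Rightarrow> bool" where
  "scp_run C P A T \<phi> \<epsilon> X Q z S \<longleftrightarrow>
     (\<forall>i\<ge>1. scp_reached \<epsilon> X i \<longrightarrow> scp_iteration C P A T \<phi> X Q z S i)"

text \<open>
  A finite execution in which (at least) \<open>k\<close> iterations are carried out; that the method
  terminates after at most \<open>M\<close> iterations means that every such \<open>k\<close> is at most \<open>M\<close>.
\<close>
definition scp_performs ::
  "'n::{finite,linorder} rmat \<Rightarrow> 'n rmat set \<Rightarrow> 'n rmat set \<Rightarrow> real \<Rightarrow>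
   ('n rvec \<Rightarrow> real) \<Rightarrow> real \<Rightarrow> (nat \<Rightarrow> 'n rmat) \<Rightarrow> (nat \<Rightarrow> 'n rmat) \<Rightarrow>
   (nat \<Rightarrow> 'n rvec) \<Rightarrow> (nat \<Rightarrow> 'n rmat) \<Rightarrow> nat \<Rightarrow> bool" where
  "scp_performs C P A T \<phi> \<epsilon> X Q z S k \<longleftrightarrow>
     (\<forall>i\<in>{1..k}. scp_reached \<epsilon> X i \<and> scp_iteration C P A T \<phi> X Q z S i)"

end

theory Submission
  imports Defs
begin

text \<open>
  The iterates that do not meet the stopping criterion are bounded and uniformly separated in the norm
  \<open>N\<close>, and a volume argument in the space of symmetric matrices limits the number of such points.

  \<^emph>\<open>Separation.\<close> Suppose that iteration \<open>i\<close> does not stop. The cut \<open>S i\<close> has the eigenvectors of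
  \<open>X i\<close> and the eigenvalues \<open>z i\<close>, so \<open>S i \<bullet> X i = - (lambda_neg (X i) \<bullet> z i)\<close>. By the choice of \<open>z i\<close>
  this is at most \<open>- \<epsilon> / \<phi> (axis e 1)\<close> (lemma \<open>scp_cut_depth\<close>). For \<open>j > i\<close> the iterate \<open>X j\<close>
  satisfies the cut, so \<open>S i \<bullet> (X j - X i) \<ge> \<epsilon> / \<phi> (axis e 1)\<close>. Because \<open>S i\<close> is positive
  semidefinite of gauge at most one, the left-hand side is at most \<open>L * N (X j - X i)\<close>, where \<open>L\<close> is
  \<^term>\<open>L_const N \<phi>\<close> (lemma \<open>inner_le_L_const\<close>). Thus any two such iterates are at distance at least
  \<open>\<epsilon> / (L * \<phi> (axis e 1))\<close>.

  \<^emph>\<open>Boundedness.\<close> The iterates lie in the cone \<open>A\<close> and have trace at most \<open>T\<close>; by homogeneity their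
  norm is at most \<open>alpha N A * T\<close> (lemma \<open>norm_le_alpha_trace\<close>).

  \<^emph>\<open>Packing.\<close> In a space of dimension \<open>d\<close>, at most \<open>(1 + 2 * \<rho> / \<delta>) ^ d\<close> points of norm at most \<open>\<rho>\<close>
  have mutual distances at least \<open>\<delta>\<close> (lemma \<open>card_separated_le\<close>).

  The inequality with \<open>L\<close> requires that the supremum defining \<open>L\<close> is finite, that is, that the
  matrices of gauge at most one are bounded. Their eigenvalue vectors are, and the spectral theorem
  (lemma \<open>spectral_theorem\<close>) carries this over to the matrices.
\<close>

section \<open>Norms on a subspace\<close>
lemma norm_on_zero: "subspace V \<Longrightarrow> norm_on V N \<Longrightarrow> N 0 = 0"
  using subspace_0 unfolding norm_on_def by blast

lemma norm_on_diff_commute: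
  assumes "subspace V" "norm_on V N" "x \<in> V" "y \<in> V"
  shows "N (x - y) = N (y - x)"
proof -
  have "N ((-1) *\<^sub>R (x - y)) = \<bar>-1\<bar> * N (x - y)"
    using assms(2) subspace_diff[OF assms(1,3,4)] unfolding norm_on_def by blast
  thus ?thesis by simp
qed

text \<open>
  Expanding \<open>x\<close> in an orthonormal basis of \<open>V\<close>, the triangle inequality bounds \<open>N x\<close> by the sum of
  the values of \<open>N\<close> on the basis times the largest coordinate. Hence \<open>N\<close> is Lipschitz on \<open>V\<close>, and its
  minimum over the compact unit sphere of \<open>V\<close> gives the reverse comparison below.
\<close>
lemma norm_on_le_multiple:
  fixes V :: "'a::euclidean_space set"
  assumes V: "subspace V" and N: "norm_on V N"
  obtains K where "K > 0" "\<And>x. x \<in> V \<Longrightarrow> N x \<le> K * norm x"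
proof -
  obtain B where B: "B \<subseteq> V" "pairwise orthogonal B" "\<And>b. b \<in> B \<Longrightarrow> norm b = 1"
      "independent B" "span B = V"
    using orthonormal_basis_subspace[OF V] by metis
  have fin: "finite B"
    using B(4) independent_imp_finite by blast
  have sub: "(\<Sum>b\<in>D. c b *\<^sub>R b) \<in> V" if "D \<subseteq> B" for D and c :: "'a \<Rightarrow> real"
    using that B(1) V by (intro subspace_sum subspace_scale) auto
  have tri: "N (\<Sum>b\<in>D. c b *\<^sub>R b) \<le> (\<Sum>b\<in>D. \<bar>c b\<bar> * N b)"
    if "D \<subseteq> B" for D and c :: "'a \<Rightarrow> real"
    using finite_subset[OF that fin] that
  proof (induction D)
    case empty
    show ?case
      by (simp add: norm_on_zero[OF V N])
  next
    case (insert b D)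
    have "N (c b *\<^sub>R b + (\<Sum>b\<in>D. c b *\<^sub>R b)) \<le> N (c b *\<^sub>R b) + N (\<Sum>b\<in>D. c b *\<^sub>R b)"
      using N sub[of D c] sub[of "{b}" c] insert.prems by (simp add: norm_on_def)
    also have "N (c b *\<^sub>R b) = \<bar>c b\<bar> * N b"
      using N insert.prems B(1) by (auto simp: norm_on_def)
    finally show ?case
      using insert by simp
  qed
  have nonneg: "N b \<ge> 0" if "b \<in> B" for b
    using that B(1) N by (auto simp: norm_on_def)
  have "N x \<le> (1 + (\<Sum>b\<in>B. N b)) * norm x" if "x \<in> V" for x
  proof -
    have "N x = N (\<Sum>b\<in>B. (x \<bullet> b) *\<^sub>R b)"
      using orthonormal_basis_expand[OF B(2,3) _ fin] B(5) that by simp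
    also have "\<dots> \<le> (\<Sum>b\<in>B. \<bar>x \<bullet> b\<bar> * N b)"
      by (rule tri) simp
    also have "\<dots> \<le> (\<Sum>b\<in>B. norm x * N b)"
      using nonneg B(3) by (intro sum_mono mult_right_mono) (metis Cauchy_Schwarz_ineq2 mult.right_neutral)+
    also have "\<dots> \<le> (1 + (\<Sum>b\<in>B. N b)) * norm x"
      by (simp add: sum_distrib_left algebra_simps)
    finally show ?thesis .
  qed
  moreover have "1 + (\<Sum>b\<in>B. N b) > 0"
    using nonneg by (simp add: add_pos_nonneg sum_nonneg)
  ultimately show thesis by (rule that[rotated])
qed

lemma norm_on_diff_bound:
  assumes "subspace V" "norm_on V N" "x \<in> V" "y \<in> V"
  shows "\<bar>N x - N y\<bar> \<le> N (x - y)"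
proof -
  have le: "N u - N v \<le> N (u - v)" if "u \<in> V" "v \<in> V" for u v
  proof -
    have "N ((u - v) + v) \<le> N (u - v) + N v"
      using assms(2) that subspace_diff[OF assms(1) that] unfolding norm_on_def by blast
    thus ?thesis by simp
  qed
  show ?thesis
    using le[OF assms(3,4)] le[OF assms(4,3)] norm_on_diff_commute[OF assms] by simp
qed

lemma continuous_on_norm_on:
  fixes V :: "'a::euclidean_space set"
  assumes V: "subspace V" and N: "norm_on V N"
  shows "continuous_on V N"
proof -
  obtain K where K: "K > 0" "\<And>x. x \<in> V \<Longrightarrow> N x \<le> K * norm x"
    using norm_on_le_multiple[OF V N] by blast
  have "K-lipschitz_on V N"
  proof (rule lipschitz_onI)
    fix x y assume "x \<in> V" "y \<in> V"
    thus "dist (N x) (N y) \<le> K * dist x y"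
      using norm_on_diff_bound[OF V N] K(2)[of "x - y"] subspace_diff[OF V]
      by (force simp: dist_norm)
  qed (use K(1) in simp)
  thus ?thesis
    by (rule lipschitz_on_continuous_on)
qed

lemma norm_on_ge_multiple:
  fixes V :: "'a::euclidean_space set"
  assumes V: "subspace V" and N: "norm_on V N"
  obtains c where "c > 0" "\<And>x. x \<in> V \<Longrightarrow> c * norm x \<le> N x"
proof (cases "V \<inter> sphere 0 1 = {}")
  case True
  have "x = 0" if "x \<in> V" for x
  proof (rule ccontr)
    assume "x \<noteq> 0"
    hence "(1 / norm x) *\<^sub>R x \<in> V \<inter> sphere 0 1"
      using subspace_scale[OF V that] by simp
    with True show False by blast
  qed
  thus thesis
    using N by (intro that[of 1]) (auto simp: norm_on_def)
next
  case False
  have "compact (V \<inter> sphere 0 1)"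
    using closed_subspace[OF V] by (simp add: closed_Int_compact)
  then obtain u where u: "u \<in> V \<inter> sphere 0 1" "\<forall>x\<in>V \<inter> sphere 0 1. N u \<le> N x"
    using continuous_attains_inf[OF _ False] continuous_on_norm_on[OF V N]
    by (meson continuous_on_subset inf_le1)
  have "0 \<le> N u" "N u \<noteq> 0"
    using u(1) N by (auto simp: norm_on_def)
  hence pos: "N u > 0" by simp
  moreover have "N u * norm x \<le> N x" if "x \<in> V" for x
  proof (cases "x = 0")
    case True
    thus ?thesis
      using N that by (auto simp: norm_on_def)
  next
    case False
    have "(1 / norm x) *\<^sub>R x \<in> V \<inter> sphere 0 1"
      using subspace_scale[OF V that] False by simp
    hence "N u \<le> N ((1 / norm x) *\<^sub>R x)"
      using u(2) by blast
    also have "\<dots> = \<bar>1 / norm x\<bar> * N x"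
      using N that unfolding norm_on_def by blast
    finally show ?thesis
      using False by (simp add: field_simps)
  qed
  ultimately show thesis by (rule that)
qed

section \<open>Packing separated points\<close>

text \<open>
  For the packing bound to have the exponent \<open>dim V\<close> rather than the dimension of the ambient space,
  volumes are compared under maps that dilate only the coordinates in \<open>B\<close>: their determinant is
  \<open>r ^ card B\<close>.
\<close>
lemma emeasure_lborel_anisotropic_scaling:
  fixes t :: "'a::euclidean_space" and B :: "'a set"
  assumes B: "B \<subseteq> Basis" and r: "r > 0" and S: "S \<in> sets borel"
  shows "emeasure lborel S = ennreal (r ^ card B) *
    emeasure lborel ((\<lambda>x. t + (\<Sum>j\<in>Basis. ((if j \<in> B then r else 1) * (x \<bullet> j)) *\<^sub>R j)) -` S)"
proof -
  let ?c = "\<lambda>j. if j \<in> B then r else 1"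
  let ?T = "\<lambda>x. t + (\<Sum>j\<in>Basis. (?c j * (x \<bullet> j)) *\<^sub>R j)"
  have [measurable]: "?T \<in> borel \<rightarrow>\<^sub>M borel" by simp
  have prod: "(\<Prod>j\<in>Basis. \<bar>?c j\<bar>) = r ^ card B"
  proof -
    have "(\<Prod>j\<in>Basis. \<bar>?c j\<bar>) = (\<Prod>j\<in>Basis. if j \<in> B then r else 1)"
      using r by (intro prod.cong) auto
    also have "\<dots> = r ^ card B"
      using B by (simp add: prod.If_cases Int_absorb1)
    finally show ?thesis .
  qed
  have "emeasure lborel S = emeasure (density (distr lborel borel ?T) (\<lambda>_. r ^ card B)) S"
    using lborel_affine_euclidean[of ?c t] r unfolding prod by simp
  also have "\<dots> = ennreal (r ^ card B) * emeasure (distr lborel borel ?T) S"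
    using S by (simp add: emeasure_density_const)
  also have "emeasure (distr lborel borel ?T) S = emeasure lborel (?T -` S)"
    using S by (simp add: emeasure_distr)
  finally show ?thesis .
qed

text \<open>
  The balls of radius \<open>\<delta> / 2\<close> about the points are disjoint and lie in the ball of radius
  \<open>\<rho> + \<delta> / 2\<close> about \<open>0\<close>, so comparing volumes in \<open>V\<close> gives the bound. Since Lebesgue measure lives on
  the whole space, \<open>V\<close> is identified with the span of \<open>dim V\<close> of the coordinate vectors and each ball
  is thickened by a fixed cube in the remaining coordinates.
\<close>
lemma card_separated_le:
  fixes V :: "'a::euclidean_space set" and x :: "'i \<Rightarrow> 'a"
  assumes V: "subspace V" and N: "norm_on V N" and fin: "finite I"
    and x: "\<And>i. i \<in> I \<Longrightarrow> x i \<in> V" "\<And>i. i \<in> I \<Longrightarrow> N (x i) \<le> \<rho>"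
    and sep: "\<And>i j. i \<in> I \<Longrightarrow> j \<in> I \<Longrightarrow> i \<noteq> j \<Longrightarrow> \<delta> \<le> N (x i - x j)"
    and \<rho>: "\<rho> \<ge> 0" and \<delta>: "\<delta> > 0"
  shows "real (card I) \<le> (1 + 2 * \<rho> / \<delta>) ^ dim V"
proof -
  obtain U where U: "U \<subseteq> V" "pairwise orthogonal U" "\<And>b. b \<in> U \<Longrightarrow> norm b = 1"
      "independent U" "card U = dim V" "span U = V"
    using orthonormal_basis_subspace[OF V] by metis
  have finU: "finite U"
    using U(4) independent_imp_finite by blast
  have "card U \<le> card (Basis :: 'a set)"
    using U(5) dim_subset_UNIV[of V] by simp
  then obtain B where B: "B \<subseteq> (Basis :: 'a set)" "card B = card U"
    using obtain_subset_with_card_n by metis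
  have finB: "finite B"
    using B(1) finite_subset finite_Basis by blast
  obtain \<beta> where \<beta>: "bij_betw \<beta> B U"
    using finite_same_card_bij[OF finB finU B(2)] by blast
  \<comment> \<open>\<open>h\<close> is an isometry from the span of \<open>B\<close> onto \<open>V\<close> and vanishes on the other
      coordinates; \<open>c i\<close> is the point of that span with \<open>h (c i) = x i\<close>.\<close>
  define h where "h = (\<lambda>y::'a. \<Sum>b\<in>B. (y \<bullet> b) *\<^sub>R \<beta> b)"
  have lin: "linear h"
    unfolding h_def
    by (rule linearI) (simp_all add: algebra_simps sum.distrib scaleR_sum_right)
  have hV: "h y \<in> V" for y
    unfolding h_def using \<beta> U(1) by (intro subspace_sum[OF V] subspace_scale[OF V]) (auto dest: bij_betwE)
  have U1: "u \<bullet> v = (if u = v then 1 else 0)" if "u \<in> U" "v \<in> U" for u v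
    using that U(2,3) by (auto simp: pairwise_def orthogonal_def norm_eq_1)
  have h\<beta>: "h y \<bullet> \<beta> b = y \<bullet> b" if "b \<in> B" for y b
  proof -
    have "h y \<bullet> \<beta> b = (\<Sum>a\<in>B. (y \<bullet> a) * (if a = b then 1 else 0))"
      unfolding h_def inner_sum_left
    proof (rule sum.cong)
      fix a assume "a \<in> B"
      hence "\<beta> a \<bullet> \<beta> b = (if a = b then 1 else 0)"
        using that \<beta> U1[of "\<beta> a" "\<beta> b"] by (auto simp: bij_betwE dest: bij_betw_imp_inj_on inj_onD)
      thus "(y \<bullet> a) *\<^sub>R \<beta> a \<bullet> \<beta> b = (y \<bullet> a) * (if a = b then 1 else 0)"
        by simp
    qed simp
    also have "\<dots> = y \<bullet> b"
      using that finB by (simp add: if_distrib cong: if_cong)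
    finally show ?thesis .
  qed
  define c where "c = (\<lambda>i. \<Sum>b\<in>B. (x i \<bullet> \<beta> b) *\<^sub>R b)"
  have cB: "c i \<bullet> b = (if b \<in> B then x i \<bullet> \<beta> b else 0)" if "b \<in> Basis" for i b
  proof -
    have "c i \<bullet> b = (\<Sum>a\<in>B. (x i \<bullet> \<beta> a) * (if a = b then 1 else 0))"
      unfolding c_def inner_sum_left
      using that B(1) by (intro sum.cong) (auto simp: inner_Basis)
    also have "\<dots> = (if b \<in> B then x i \<bullet> \<beta> b else 0)"
      using finB by (simp add: sum.delta' if_distrib cong: if_cong)
    finally show ?thesis .
  qed
  have hc: "h (c i) = x i" if "i \<in> I" for i
  proof -
    have "h (c i) = (\<Sum>b\<in>B. (x i \<bullet> \<beta> b) *\<^sub>R \<beta> b)"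
      unfolding h_def using B(1) cB by (intro sum.cong) auto
    also have "\<dots> = (\<Sum>u\<in>U. (x i \<bullet> u) *\<^sub>R u)"
      using sum.reindex_bij_betw[OF \<beta>] by simp
    also have "\<dots> = x i"
      using orthonormal_basis_expand[OF U(2,3) _ finU] U(6) x(1)[OF that] by simp
    finally show ?thesis .
  qed
  \<comment> \<open>The ball of radius \<open>r\<close> about \<open>t\<close> in the span of \<open>B\<close>, times a cube in the other coordinates.\<close>
  define K where "K = (\<lambda>t r. {y. N (h (y - t)) < r \<and> (\<forall>b\<in>Basis - B. \<bar>y \<bullet> b\<bar> < 1)})"
  have openK: "open (K t r)" for t r
  proof -
    have "continuous_on UNIV (\<lambda>y. h (y - t))"
      by (intro continuous_intros linear_continuous_on_compose[OF _ lin])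
    hence "continuous_on UNIV (\<lambda>y. N (h (y - t)))"
      using continuous_on_compose2[OF continuous_on_norm_on[OF V N]] hV by blast
    hence "open ({y. N (h (y - t)) < r} \<inter> (\<Inter>b\<in>Basis - B. {y. \<bar>y \<bullet> b\<bar> < 1}))"
      by (intro open_Int open_INT ballI open_Collect_less continuous_intros) auto
    moreover have "K t r = {y. N (h (y - t)) < r} \<inter> (\<Inter>b\<in>Basis - B. {y. \<bar>y \<bullet> b\<bar> < 1})"
      by (auto simp: K_def)
    ultimately show ?thesis by simp
  qed
  have volK: "emeasure lborel (K t r) = ennreal (r ^ dim V) * emeasure lborel (K 0 1)"
    if r: "r > 0" and t: "\<And>b. b \<in> Basis - B \<Longrightarrow> t \<bullet> b = 0" for t r
  proof -
    let ?T = "\<lambda>y. t + (\<Sum>j\<in>Basis. ((if j \<in> B then r else 1) * (y \<bullet> j)) *\<^sub>R j)"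
    have hT: "h (?T y - t) = r *\<^sub>R h y" for y
      unfolding h_def using B(1) by (auto simp: scaleR_sum_right intro!: sum.cong)
    have NT: "N (h (?T y - t)) = r * N (h y)" for y
      using N hV r unfolding hT norm_on_def by simp
    have coord: "?T y \<bullet> b = y \<bullet> b" if "b \<in> Basis - B" for y b
      using that t by (simp add: inner_add_left)
    have "?T -` K t r = K 0 1"
      unfolding K_def using NT coord r by auto
    thus ?thesis
      using emeasure_lborel_anisotropic_scaling[OF B(1) r, of "K t r" t] openK B(2) U(5) by simp
  qed
  have bdd: "bounded (K 0 1)"
  proof -
    obtain \<kappa> where \<kappa>: "\<kappa> > 0" "\<And>v. v \<in> V \<Longrightarrow> \<kappa> * norm v \<le> N v"
      using norm_on_ge_multiple[OF V N] by blast
    have "\<bar>y \<bullet> b\<bar> \<le> 1 / \<kappa> + 1" if y: "y \<in> K 0 1" and b: "b \<in> Basis" for y b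
    proof (cases "b \<in> B")
      case True
      have "\<bar>y \<bullet> b\<bar> = \<bar>h y \<bullet> \<beta> b\<bar>"
        using True h\<beta> by simp
      also have "\<dots> \<le> norm (h y) * norm (\<beta> b)"
        by (rule Cauchy_Schwarz_ineq2)
      also have "\<dots> = norm (h y)"
        using U(3) \<beta> True by (simp add: bij_betwE)
      also have "\<dots> \<le> 1 / \<kappa>"
        using \<kappa>(2)[OF hV[of y]] \<kappa>(1) y by (simp add: K_def field_simps)
      finally show ?thesis by simp
    next
      case False
      hence "\<bar>y \<bullet> b\<bar> < 1"
        using y b by (simp add: K_def)
      moreover have "1 / \<kappa> > 0"
        using \<kappa>(1) by simp
      ultimately show ?thesis by linarith
    qed
    hence "norm y \<le> (\<Sum>b\<in>(Basis::'a set). 1 / \<kappa> + 1)" if "y \<in> K 0 1" for y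
      using that by (intro order_trans[OF norm_le_l1] sum_mono) auto
    thus ?thesis
      unfolding bounded_iff by blast
  qed
  define m where "m = measure lborel (K 0 1)"
  have m: "emeasure lborel (K 0 1) = ennreal m"
    unfolding m_def using emeasure_bounded_finite[OF bdd] by (simp add: emeasure_eq_ennreal_measure)
  have m_pos: "m > 0"
  proof -
    have "0 \<in> K 0 1"
      using norm_on_zero[OF V N] linear_0[OF lin] by (simp add: K_def)
    hence "\<not> negligible (K 0 1)"
      using open_not_negligible openK by blast
    hence "emeasure lborel (K 0 1) \<noteq> 0"
      using openK by (auto simp: negligible_iff_null_sets null_sets_def borel_open)
    thus ?thesis
      using m by (metis ennreal_0 m_def measure_nonneg order_less_le)
  qed
  have c0: "c i \<bullet> b = 0" if "b \<in> Basis - B" for i b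
    using cB that by simp
  have sub: "(\<Union>i\<in>I. K (c i) (\<delta> / 2)) \<subseteq> K 0 (\<rho> + \<delta> / 2)"
  proof
    fix y assume "y \<in> (\<Union>i\<in>I. K (c i) (\<delta> / 2))"
    then obtain i where i: "i \<in> I" "y \<in> K (c i) (\<delta> / 2)" by blast
    have "N (h y) = N (h (y - c i) + x i)"
      using hc[OF i(1)] by (simp add: linear_diff[OF lin])
    also have "\<dots> \<le> N (h (y - c i)) + N (x i)"
      using N hV x(1)[OF i(1)] by (simp add: norm_on_def)
    finally have "N (h y) < \<rho> + \<delta> / 2"
      using i(2) x(2)[OF i(1)] by (simp add: K_def)
    with i(2) show "y \<in> K 0 (\<rho> + \<delta> / 2)"
      by (simp add: K_def)
  qed
  have disj: "disjoint_family_on (\<lambda>i. K (c i) (\<delta> / 2)) I"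
    unfolding disjoint_family_on_def
  proof (intro ballI impI, rule ccontr)
    fix i j assume ij: "i \<in> I" "j \<in> I" "i \<noteq> j" "K (c i) (\<delta> / 2) \<inter> K (c j) (\<delta> / 2) \<noteq> {}"
    then obtain y where y: "N (h (y - c i)) < \<delta> / 2" "N (h (y - c j)) < \<delta> / 2"
      by (auto simp: K_def)
    have "x i - x j = h (y - c j) - h (y - c i)"
      using hc ij(1,2) by (simp add: linear_diff[OF lin])
    also have "N \<dots> \<le> N (h (y - c j)) + N (h (y - c i))"
    proof -
      have "N (h (y - c j) + (-1) *\<^sub>R h (y - c i)) \<le> N (h (y - c j)) + N ((-1) *\<^sub>R h (y - c i))"
        using N hV subspace_scale[OF V hV] unfolding norm_on_def by blast
      moreover have "N ((-1) *\<^sub>R h (y - c i)) = \<bar>-1\<bar> * N (h (y - c i))"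
        using N hV unfolding norm_on_def by blast
      ultimately show ?thesis by simp
    qed
    finally show False
      using y sep[OF ij(1-3)] by simp
  qed
  have "ennreal (real (card I) * ((\<delta> / 2) ^ dim V * m)) =
      (\<Sum>i\<in>I. emeasure lborel (K (c i) (\<delta> / 2)))"
    using volK[OF _ c0] \<delta> m m_pos
    by (simp add: ennreal_mult ennreal_of_nat_eq_real_of_nat)
  also have "\<dots> = emeasure lborel (\<Union>i\<in>I. K (c i) (\<delta> / 2))"
    using disj fin openK by (intro sum_emeasure) (auto simp: borel_open)
  also have "\<dots> \<le> emeasure lborel (K 0 (\<rho> + \<delta> / 2))"
    using sub openK by (intro emeasure_mono) (auto simp: borel_open)
  also have "\<dots> = ennreal ((\<rho> + \<delta> / 2) ^ dim V * m)"
    using volK[of "\<rho> + \<delta> / 2" 0] \<rho> \<delta> m m_pos by (simp add: ennreal_mult)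
  finally have "real (card I) * (\<delta> / 2) ^ dim V * m \<le> (\<rho> + \<delta> / 2) ^ dim V * m"
    using \<rho> \<delta> m_pos by (simp add: mult.assoc)
  hence "real (card I) * (\<delta> / 2) ^ dim V \<le> (\<rho> + \<delta> / 2) ^ dim V"
    using m_pos by simp
  hence "real (card I) \<le> ((\<rho> + \<delta> / 2) / (\<delta> / 2)) ^ dim V"
    using \<delta> unfolding power_divide by (subst pos_le_divide_eq) auto
  also have "(\<rho> + \<delta> / 2) / (\<delta> / 2) = 1 + 2 * \<rho> / \<delta>"
    using \<delta> by (simp add: field_simps)
  finally show ?thesis .
qed

section \<open>The spectral theorem\<close>

text \<open>
  A maximiser \<open>v\<close> of the quadratic form on the unit sphere of \<open>V\<close> is an eigenvector: perturbing \<open>v\<close> in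
  the direction of the residual \<open>g = f v - c v\<close> raises the Rayleigh quotient to first order unless
  \<open>g = 0\<close>.
\<close>
lemma selfadjoint_eigenvector:
  fixes f :: "'a::euclidean_space \<Rightarrow> 'a"
  assumes lin: "linear f" and sa: "\<And>x y. f x \<bullet> y = x \<bullet> f y"
    and V: "subspace V" "f ` V \<subseteq> V" "V \<noteq> {0}"
  obtains v c where "v \<in> V" "norm v = 1" "f v = c *\<^sub>R v"
proof -
  obtain w where w: "w \<in> V" "w \<noteq> 0"
    using V(3) subspace_0[OF V(1)] by blast
  hence "(1 / norm w) *\<^sub>R w \<in> V \<inter> sphere 0 1"
    using subspace_scale[OF V(1)] by simp
  hence ne: "V \<inter> sphere 0 1 \<noteq> {}" by blast
  have "compact (V \<inter> sphere 0 1)"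
    using closed_subspace[OF V(1)] by (simp add: closed_Int_compact)
  moreover have "continuous_on (V \<inter> sphere 0 1) (\<lambda>x. x \<bullet> f x)"
    by (intro continuous_intros linear_continuous_on_compose[OF _ lin])
  ultimately obtain v where v: "v \<in> V" "norm v = 1"
      and max: "\<And>x. x \<in> V \<Longrightarrow> norm x = 1 \<Longrightarrow> x \<bullet> f x \<le> v \<bullet> f v"
    using continuous_attains_sup[OF _ ne] by fastforce
  define c where "c = v \<bullet> f v"
  have quad: "x \<bullet> f x \<le> c * (x \<bullet> x)" if "x \<in> V" for x
  proof (cases "x = 0")
    case False
    let ?u = "(1 / norm x) *\<^sub>R x"
    have "?u \<bullet> f ?u \<le> c"
      unfolding c_def by (rule max[OF subspace_scale[OF V(1) that]]) (use False in simp)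
    moreover have "?u \<bullet> f ?u = (x \<bullet> f x) / (x \<bullet> x)"
      by (simp add: linear_scale[OF lin] dot_square_norm power2_eq_square)
    ultimately have "(x \<bullet> f x) / (x \<bullet> x) \<le> c" by simp
    thus ?thesis
      using False by (subst (asm) pos_divide_le_eq) auto
  qed (simp add: linear_0[OF lin])
  define g where "g = f v - c *\<^sub>R v"
  have gV: "g \<in> V"
    unfolding g_def using V v(1) by (intro subspace_diff subspace_scale) auto
  have lower: "2 * t * (g \<bullet> g) \<le> t\<^sup>2 * (c * (g \<bullet> g) - g \<bullet> f g)" for t
  proof -
    have vv: "v \<bullet> v = 1"
      using v(2) by (simp add: norm_eq_1)
    have "(v + t *\<^sub>R g) \<bullet> f (v + t *\<^sub>R g) \<le> c * ((v + t *\<^sub>R g) \<bullet> (v + t *\<^sub>R g))"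
      using subspace_add[OF V(1) v(1) subspace_scale[OF V(1) gV]] by (rule quad)
    hence "c + 2 * t * (g \<bullet> f v) + t\<^sup>2 * (g \<bullet> f g) \<le>
        c + 2 * t * (c * (g \<bullet> v)) + t\<^sup>2 * (c * (g \<bullet> g))"
      using vv sa[of v g]
      by (simp add: linear_add[OF lin] linear_scale[OF lin] inner_add_left inner_add_right
          c_def[symmetric] inner_commute[of v g] inner_commute[of "f v" g] power2_eq_square algebra_simps)
    moreover have "g \<bullet> f v = g \<bullet> g + c * (g \<bullet> v)"
      by (subst (3) g_def) (simp add: inner_diff_right)
    ultimately have "c + 2 * t * (g \<bullet> g + c * (g \<bullet> v)) + t\<^sup>2 * (g \<bullet> f g) \<le>
        c + 2 * t * (c * (g \<bullet> v)) + t\<^sup>2 * (c * (g \<bullet> g))"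
      by (simp only:)
    thus ?thesis
      by (simp add: algebra_simps)
  qed
  have "g \<bullet> g \<le> 0"
  proof (rule ccontr)
    assume "\<not> g \<bullet> g \<le> 0"
    hence pos: "g \<bullet> g > 0" by linarith
    \<comment> \<open>At \<open>t = (g \<bullet> g) / D\<close> the quadratic term is at most half of the linear one.\<close>
    define D where "D = \<bar>c * (g \<bullet> g) - g \<bullet> f g\<bar> + 1"
    define t where "t = (g \<bullet> g) / D"
    have D: "D > 0" by (simp add: D_def)
    have t: "t > 0" using pos D by (simp add: t_def)
    have "2 * t * (g \<bullet> g) \<le> t\<^sup>2 * D"
      using lower[of t] by (rule order_trans) (simp add: D_def mult_left_mono)
    also have "\<dots> = t * (g \<bullet> g)"
      using D by (simp add: t_def power2_eq_square)
    finally show False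
      using t pos by simp
  qed
  hence "g = 0"
    using inner_ge_zero[of g] inner_eq_zero_iff[of g] by linarith
  hence "f v = c *\<^sub>R v"
    by (simp add: g_def)
  with v show thesis by (rule that)
qed

text \<open>
  An orthonormal set of eigenvectors of largest size spans everything: its orthogonal complement is
  invariant, so if it were nonzero it would contain one more eigenvector.
\<close>
lemma selfadjoint_orthonormal_eigenbasis:
  fixes f :: "'a::euclidean_space \<Rightarrow> 'a"
  assumes lin: "linear f" and sa: "\<And>x y. f x \<bullet> y = x \<bullet> f y"
  obtains B where "pairwise orthogonal B" "\<And>b. b \<in> B \<Longrightarrow> norm b = 1"
    "\<And>b. b \<in> B \<Longrightarrow> \<exists>c. f b = c *\<^sub>R b" "card B = DIM('a)"
proof -
  define \<B> where "\<B> = {B. pairwise orthogonal B \<and> (\<forall>b\<in>B. norm b = 1 \<and> (\<exists>c. f b = c *\<^sub>R b))}"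
  have ind: "independent B" if "B \<in> \<B>" for B
    using that by (intro pairwise_orthogonal_independent) (auto simp: \<B>_def)
  have "card B \<le> DIM('a)" if "B \<in> \<B>" for B
    using ind[OF that] independent_bound by auto
  hence "\<forall>B. B \<in> \<B> \<longrightarrow> card B < Suc DIM('a)"
    by (simp add: less_Suc_eq_le)
  moreover have "{} \<in> \<B>"
    by (simp add: \<B>_def)
  ultimately obtain B where B: "B \<in> \<B>" and max: "\<And>B'. B' \<in> \<B> \<Longrightarrow> card B' \<le> card B"
    using ex_has_greatest_nat[of "\<lambda>B. B \<in> \<B>" "{}" card] by blast
  have eig: "\<exists>c. f b = c *\<^sub>R b" if "b \<in> B" for b
    using B that by (simp add: \<B>_def)
  have finB: "finite B"
    using ind[OF B] independent_imp_finite by blast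
  define V where "V = {x. \<forall>b\<in>B. b \<bullet> x = 0}"
  have V: "subspace V"
    by (auto simp: V_def subspace_def inner_add_right)
  have inv: "f ` V \<subseteq> V"
  proof clarify
    fix x assume x: "x \<in> V"
    have "b \<bullet> f x = 0" if "b \<in> B" for b
    proof -
      obtain c where "f b = c *\<^sub>R b"
        using eig[OF \<open>b \<in> B\<close>] ..
      hence "b \<bullet> f x = c * (b \<bullet> x)"
        by (simp only: sa[symmetric] inner_scaleR_left)
      also have "\<dots> = 0"
        using x that by (simp add: V_def)
      finally show ?thesis .
    qed
    thus "f x \<in> V" by (simp add: V_def)
  qed
  have "V = {0}"
  proof (rule ccontr)
    assume "V \<noteq> {0}"
    then obtain v c where v: "v \<in> V" "norm v = 1" "f v = c *\<^sub>R v"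
      using selfadjoint_eigenvector[OF lin sa V inv] by blast
    have "insert v B \<in> \<B>"
      using B v by (auto simp: \<B>_def V_def pairwise_insert orthogonal_def inner_commute)
    moreover have "v \<notin> B"
      using v by (auto simp: V_def)
    ultimately show False
      using max[of "insert v B"] finB by simp
  qed
  have span: "span B = UNIV"
  proof (rule ccontr)
    assume "span B \<noteq> UNIV"
    hence "dim B < DIM('a)"
      using dim_eq_full[of B] dim_subset_UNIV[of B] by linarith
    then obtain x where "x \<noteq> 0" "\<And>y. y \<in> span B \<Longrightarrow> orthogonal x y"
      using orthogonal_to_subspace_exists by blast
    hence "x \<in> V" "x \<noteq> 0"
      by (auto simp: V_def orthogonal_def inner_commute span_base)
    with \<open>V = {0}\<close> show False by blast
  qed
  have "card B = DIM('a)"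
    using ind[OF B] span by (metis dim_UNIV dim_eq_card dim_span)
  thus thesis
    using B by (intro that[of B]) (auto simp: \<B>_def)
qed

lemma spectral_theorem:
  fixes S :: "real^'n^'n"
  assumes S: "S \<in> sym_mats"
  obtains Q v where "orthogonal_matrix Q" "S = Q ** diag v ** transpose Q"
proof -
  have sa: "(S *v x) \<bullet> y = x \<bullet> (S *v y)" for x y
    using S dot_lmul_matrix[of x S y] transpose_matrix_vector[of S x]
    by (simp add: sym_mats_def)
  obtain B where B: "pairwise orthogonal B" "\<And>b. b \<in> B \<Longrightarrow> norm b = 1"
      "\<And>b. b \<in> B \<Longrightarrow> \<exists>c. S *v b = c *\<^sub>R b" "card B = DIM(real^'n)"
    using selfadjoint_orthonormal_eigenbasis[OF matrix_vector_mul_linear sa] by metis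
  have "finite B"
    using B(4) by (intro card_ge_0_finite) simp
  then obtain q where q: "bij_betw q (UNIV :: 'n set) B"
    using finite_same_card_bij[of "UNIV :: 'n set" B] B(4) by auto
  hence qB: "q i \<in> B" for i
    by (auto simp: bij_betw_def)
  obtain e where e: "\<And>b. b \<in> B \<Longrightarrow> S *v b = e b *\<^sub>R b"
    using B(3) by metis
  define Q :: "real^'n^'n" where "Q = (\<chi> i j. q j $ i)"
  have qq: "q i \<bullet> q j = (if i = j then 1 else 0)" for i j
  proof (cases "i = j")
    case True
    thus ?thesis
      using B(2)[OF qB] by (simp add: norm_eq_1)
  next
    case False
    hence "q i \<noteq> q j"
      using q by (simp add: bij_betw_imp_inj_on inj_eq)
    thus ?thesis
      using False qB B(1) by (simp add: pairwise_def orthogonal_def)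
  qed
  have "transpose Q ** Q = mat 1"
    using qq by (simp add: vec_eq_iff matrix_matrix_mult_def transpose_def Q_def mat_def inner_vec_def)
  hence orth: "orthogonal_matrix Q"
    by (simp add: orthogonal_matrix)
  have "S ** Q = Q ** diag (\<chi> i. e (q i))"
  proof -
    have "(S ** Q) $ i $ j = (Q ** diag (\<chi> i. e (q i))) $ i $ j" for i j
    proof -
      have "(S ** Q) $ i $ j = (S *v q j) $ i"
        by (simp add: matrix_matrix_mult_def matrix_vector_mult_def Q_def)
      also have "\<dots> = q j $ i * e (q j)"
        using e[OF qB] by simp
      also have "\<dots> = (Q ** diag (\<chi> i. e (q i))) $ i $ j"
        by (simp add: matrix_matrix_mult_def Q_def diag_def if_distrib cong: if_cong)
      finally show ?thesis .
    qed
    thus ?thesis by (simp add: vec_eq_iff)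
  qed
  hence "(S ** Q) ** transpose Q = Q ** diag (\<chi> i. e (q i)) ** transpose Q"
    by simp
  moreover have "(S ** Q) ** transpose Q = S"
    using orth by (simp add: matrix_mul_assoc[symmetric] orthogonal_matrix_def)
  ultimately show thesis
    using that orth by metis
qed

section \<open>Matrices with a given eigendecomposition\<close>

lemma subspace_sym_mats: "subspace (sym_mats :: (real^'n^'n) set)"
  by (auto simp: sym_mats_def subspace_def transpose_def vec_eq_iff)

lemma transpose_diag [simp]: "transpose (diag v) = diag v"
  by (auto simp: diag_def transpose_def vec_eq_iff)

lemma diag_mult_vec: "diag v *v x = (\<chi> i. v $ i * x $ i)"
proof -
  have "(\<Sum>j\<in>UNIV. (if i = j then v $ i else 0) * x $ j) =
      (\<Sum>j\<in>UNIV. if i = j then v $ i * x $ j else 0)" for i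
    by (intro sum.cong) auto
  thus ?thesis
    by (simp add: matrix_vector_mult_def diag_def vec_eq_iff)
qed

lemma diag_mult_diag: "diag v ** diag w = diag (\<chi> i. v $ i * w $ i)"
proof -
  have "(\<Sum>k\<in>UNIV. diag v $ i $ k * diag w $ k $ j) =
      (\<Sum>k\<in>UNIV. if i = k then diag (\<chi> i. v $ i * w $ i) $ i $ j else 0)" for i j
    by (intro sum.cong) (auto simp: diag_def)
  thus ?thesis
    by (simp add: matrix_matrix_mult_def vec_eq_iff)
qed

lemma orthogonal_conj_diag_sym:
  "Q ** diag v ** transpose Q \<in> sym_mats" for Q :: "real^'n^'n"
  by (simp add: sym_mats_def matrix_transpose_mul matrix_mul_assoc)

text \<open>
  The rank-one matrices \<open>q\<^sub>i q\<^sub>i\<^sup>T\<close> formed from the columns of \<open>Q\<close> are orthonormal. With \<open>v = w\<close> this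
  identifies the Frobenius norm; with \<open>v \<noteq> w\<close> it evaluates a cut at the iterate it is built from.
\<close>
lemma inner_orthogonal_conj_diag:
  fixes Q :: "real^'n^'n"
  assumes Q: "orthogonal_matrix Q"
  shows "(Q ** diag v ** transpose Q) \<bullet> (Q ** diag w ** transpose Q) = v \<bullet> w"
proof -
  have QQ: "transpose Q ** Q = mat 1"
    using Q by (simp add: orthogonal_matrix_def)
  have "(Q ** diag v ** transpose Q) ** (Q ** diag w ** transpose Q) =
      Q ** (diag v ** (transpose Q ** Q) ** diag w ** transpose Q)"
    by (simp only: matrix_mul_assoc)
  hence "(Q ** diag v ** transpose Q) \<bullet> (Q ** diag w ** transpose Q) =
      trace (Q ** (diag v ** diag w ** transpose Q))"
    using orthogonal_conj_diag_sym[of Q v]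
    by (simp add: frobenius_inner sym_mats_def QQ)
  also have "\<dots> = trace (diag v ** diag w ** (transpose Q ** Q))"
    by (subst trace_mul_sym) (simp only: matrix_mul_assoc)
  also have "\<dots> = v \<bullet> w"
    unfolding QQ matrix_mul_rid diag_mult_diag by (simp add: trace_def diag_def inner_vec_def)
  finally show ?thesis .
qed

lemma psd_orthogonal_conj_diag:
  fixes Q :: "real^'n^'n"
  assumes "\<And>i. 0 \<le> v $ i"
  shows "Q ** diag v ** transpose Q \<in> psd_mats"
proof -
  have "0 \<le> x \<bullet> ((Q ** diag v ** transpose Q) *v x)" for x
  proof -
    let ?y = "transpose Q *v x"
    have "x \<bullet> ((Q ** diag v ** transpose Q) *v x) = x \<bullet> (Q *v (diag v *v ?y))"
      by (simp only: matrix_vector_mul_assoc matrix_mul_assoc)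
    also have "\<dots> = ?y \<bullet> (diag v *v ?y)"
      by (simp add: dot_lmul_matrix[symmetric])
    also have "\<dots> = (\<Sum>i\<in>UNIV. v $ i * (?y $ i)\<^sup>2)"
      by (simp add: inner_vec_def diag_mult_vec power2_eq_square mult_ac del: transpose_matrix_vector)
    also have "\<dots> \<ge> 0"
      using assms by (intro sum_nonneg mult_nonneg_nonneg) auto
    finally show ?thesis .
  qed
  thus ?thesis
    using orthogonal_conj_diag_sym by (auto simp: psd_mats_def)
qed

lemma matrix_diff_distrib:
  fixes A B C :: "'a::comm_ring_1^'n^'n"
  shows "A ** (B - C) = A ** B - A ** C" "(A - B) ** C = A ** C - B ** C"
  by (simp_all add: matrix_matrix_mult_def vec_eq_iff sum_subtractf algebra_simps)

text \<open>
  Since \<^const>\<open>lambda\<close> lists the eigenvalues in nondecreasing order whereas the diagonal of an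
  eigendecomposition comes in any order, a sorting permutation links the two; symmetric gauges do not
  see it.
\<close>
lemma mono_rearrangement:
  fixes v :: "'n::{finite,linorder} rvec"
  obtains p where "p permutes UNIV" "mono (\<lambda>i. v $ p i)"
proof -
  define l where "l = sorted_list_of_set (UNIV :: 'n set)"
  define m where "m = sort_key (\<lambda>i. v $ i) l"
  have l: "sorted l" "set l = UNIV" "distinct l"
    by (auto simp: l_def)
  have m: "set m = UNIV" "distinct m" "length m = length l" "sorted (map (\<lambda>i. v $ i) m)"
    using l by (auto simp: m_def)
  define r where "r = inv_into {..<length l} ((!) l)"
  have bl: "bij_betw ((!) l) {..<length l} UNIV"
    using bij_betw_nth[OF l(3)] l(2) by simp
  have br: "bij_betw r UNIV {..<length l}"
    unfolding r_def using bij_betw_inv_into[OF bl] .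
  have bm: "bij_betw ((!) m) {..<length l} UNIV"
    using bij_betw_nth[OF m(2)] m(1,3) by simp
  define p where "p = (!) m \<circ> r"
  have "bij_betw p UNIV UNIV"
    unfolding p_def using br bm by (rule bij_betw_trans)
  hence "p permutes UNIV"
    by (intro bij_imp_permutes) auto
  moreover have "mono (\<lambda>i. v $ p i)"
  proof (rule monoI)
    fix i j :: 'n assume ij: "i \<le> j"
    have lt: "r i < length l" "r j < length l"
      using br by (auto dest: bij_betwE)
    have lr: "l ! r i = i" "l ! r j = j"
      unfolding r_def using bl by (simp_all add: bij_betw_inv_into_right)
    have "r i \<le> r j"
    proof (rule ccontr)
      assume "\<not> r i \<le> r j"
      hence "l ! r j \<le> l ! r i"
        using sorted_nth_mono[OF l(1)] lt by simp
      hence "i = j" using lr ij by simp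
      with \<open>\<not> r i \<le> r j\<close> show False by simp
    qed
    thus "v $ p i \<le> v $ p j"
      using sorted_nth_mono[OF m(4), of "r i" "r j"] lt m(3) by (simp add: p_def)
  qed
  ultimately show thesis by (rule that)
qed

lemma lambda_orthogonal_conj_diag:
  fixes Q :: "'n::{finite,linorder} rmat"
  assumes Q: "orthogonal_matrix Q"
  obtains p where "p permutes UNIV" "lambda (Q ** diag v ** transpose Q) = (\<chi> i. v $ p i)"
proof -
  obtain p where p: "p permutes UNIV" "mono (\<lambda>i. v $ p i)"
    using mono_rearrangement by blast
  have "det (mat t - Q ** diag v ** transpose Q) = (\<Prod>i\<in>UNIV. t - (\<chi> i. v $ p i) $ i)" for t
  proof -
    have QQ: "Q ** transpose Q = mat 1"
      using Q by (simp add: orthogonal_matrix_def)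
    have "Q ** mat t = t *\<^sub>R Q"
      by (simp add: matrix_matrix_mult_def mat_def vec_eq_iff if_distrib mult.commute cong: if_cong)
    hence "Q ** mat t ** transpose Q = t *\<^sub>R mat 1"
      using QQ by (simp add: scalar_matrix_assoc[symmetric])
    also have "\<dots> = mat t"
      by (simp add: mat_def vec_eq_iff)
    finally have "mat t - Q ** diag v ** transpose Q = Q ** (mat t - diag v) ** transpose Q"
      by (simp add: matrix_diff_distrib)
    hence "det (mat t - Q ** diag v ** transpose Q) = det (Q ** transpose Q) * det (mat t - diag v)"
      by (simp add: det_mul)
    also have "\<dots> = (\<Prod>i\<in>UNIV. t - v $ i)"
    proof -
      have "mat t - diag v = diag (\<chi> i. t - v $ i)"
        by (simp add: mat_def diag_def vec_eq_iff)
      thus ?thesis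
        using det_diagonal[of "diag (\<chi> i. t - v $ i)"] by (simp add: QQ diag_def)
    qed
    also have "\<dots> = (\<Prod>i\<in>UNIV. t - v $ p i)"
      using prod.permute[OF p(1), of "\<lambda>i. t - v $ i"] by (simp add: o_def)
    finally show ?thesis by simp
  qed
  hence "lambda (Q ** diag v ** transpose Q) = (\<chi> i. v $ p i)"
    using p(2) by (intro lambda_eqI) auto
  with p(1) show thesis by (rule that)
qed

lemma symmetric_gauge_lambda:
  fixes Q :: "'n::{finite,linorder} rmat"
  assumes "symmetric_gauge \<phi>" "orthogonal_matrix Q"
  shows "\<phi> (lambda (Q ** diag v ** transpose Q)) = \<phi> v"
proof -
  obtain p where "p permutes UNIV" "lambda (Q ** diag v ** transpose Q) = (\<chi> i. v $ p i)"
    using lambda_orthogonal_conj_diag[OF assms(2)] .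
  thus ?thesis
    using assms(1) by (simp add: symmetric_gauge_def)
qed

lemma symmetric_gauge_axis:
  fixes \<phi> :: "real^'n \<Rightarrow> real"
  assumes "symmetric_gauge \<phi>"
  shows "\<phi> (axis i 1) = \<phi> (axis j 1)"
proof -
  have "\<phi> (\<chi> k. axis j 1 $ Transposition.transpose i j k) = \<phi> (axis j 1)"
    using assms permutes_swap_id[of i UNIV j] by (simp add: symmetric_gauge_def)
  moreover have "(\<chi> k. axis j 1 $ Transposition.transpose i j k) = (axis i 1 :: real^'n)"
    by (auto simp: vec_eq_iff axis_def Transposition.transpose_def)
  ultimately show ?thesis by simp
qed

section \<open>The constants of the iteration bound\<close>

text \<open>
  By the spectral theorem the Frobenius norm of \<open>S\<close> is the Euclidean norm of its eigenvalue vector,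
  which \<open>\<phi>\<close> controls. This boundedness makes the supremum in \<^const>\<open>L_const\<close> a genuine upper bound;
  an unbounded supremum of reals would carry no information.
\<close>
lemma bounded_gauge_ball:
  fixes \<phi> :: "'n::{finite,linorder} rvec \<Rightarrow> real"
  assumes \<phi>: "symmetric_gauge \<phi>"
  shows "bounded (gauge_ball \<phi>)"
proof -
  have "norm_on UNIV \<phi>"
    using \<phi> by (simp add: symmetric_gauge_def)
  then obtain c where c: "c > 0" "\<And>v. c * norm v \<le> \<phi> v"
    using norm_on_ge_multiple[OF subspace_UNIV] by (metis UNIV_I)
  have "norm S \<le> 1 / c" if S: "S \<in> gauge_ball \<phi>" for S
  proof -
    obtain Q v where Q: "orthogonal_matrix Q" and SQ: "S = Q ** diag v ** transpose Q"
      using S spectral_theorem by (auto simp: gauge_ball_def)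
    have "norm S = norm v"
      unfolding SQ norm_eq_sqrt_inner inner_orthogonal_conj_diag[OF Q] ..
    moreover have "c * norm v \<le> 1"
      using S c(2)[of v] symmetric_gauge_lambda[OF \<phi> Q, of v] by (simp add: gauge_ball_def SQ)
    ultimately show ?thesis
      using c(1) by (simp add: field_simps)
  qed
  thus ?thesis
    unfolding bounded_iff by blast
qed

text \<open>
  The first bound is needed for the finiteness of \<^const>\<open>L_const\<close>, the second is the generalised
  Cauchy--Schwarz inequality. Both rest on the comparison of \<open>N\<close> with the Frobenius norm, which makes
  the unit ball of \<open>N\<close> bounded.
\<close>
lemma dual_norm_bounds:
  fixes N :: "real^'n^'n \<Rightarrow> real"
  assumes N: "norm_on sym_mats N"
  obtains K where "\<And>S. dual_norm N S \<le> K * norm S"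
    "\<And>S X. X \<in> sym_mats \<Longrightarrow> \<bar>S \<bullet> X\<bar> \<le> dual_norm N S * N X"
proof -
  obtain c where c: "c > 0" "\<And>X. X \<in> sym_mats \<Longrightarrow> c * norm X \<le> N X"
    using norm_on_ge_multiple[OF subspace_sym_mats N] by metis
  have ball: "\<bar>S \<bullet> X\<bar> \<le> 1 / c * norm S" if "X \<in> sym_mats" "N X \<le> 1" for S X
  proof -
    have "norm X \<le> 1 / c"
      using c(1) c(2)[OF that(1)] that(2) by (simp add: field_simps)
    hence "norm S * norm X \<le> norm S * (1 / c)"
      by (intro mult_left_mono) auto
    thus ?thesis
      using Cauchy_Schwarz_ineq2[of S X] by simp
  qed
  have "N 0 = 0"
    using norm_on_zero[OF subspace_sym_mats N] .
  hence ne: "{X \<in> sym_mats. N X \<le> 1} \<noteq> {}"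
    using subspace_0[OF subspace_sym_mats] by force
  have bdd: "bdd_above ((\<lambda>X. \<bar>S \<bullet> X\<bar>) ` {X \<in> sym_mats. N X \<le> 1})" for S
    using ball by (intro bdd_aboveI2) auto
  have "dual_norm N S \<le> 1 / c * norm S" for S
    unfolding dual_norm_def using ne ball by (intro cSUP_least) auto
  moreover have "\<bar>S \<bullet> X\<bar> \<le> dual_norm N S * N X" if X: "X \<in> sym_mats" for S X
  proof (cases "X = 0")
    case True
    thus ?thesis
      using \<open>N 0 = 0\<close> by simp
  next
    case False
    have "N X \<ge> 0" "N X \<noteq> 0"
      using N X False unfolding norm_on_def by blast+
    hence pos: "N X > 0" by simp
    let ?Y = "(1 / N X) *\<^sub>R X"
    have "N ?Y = \<bar>1 / N X\<bar> * N X"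
      using N X unfolding norm_on_def by blast
    hence "?Y \<in> {X \<in> sym_mats. N X \<le> 1}"
      using pos subspace_scale[OF subspace_sym_mats X] by simp
    hence "\<bar>S \<bullet> ?Y\<bar> \<le> dual_norm N S"
      unfolding dual_norm_def using bdd by (intro cSUP_upper)
    thus ?thesis
      using pos by (simp add: field_simps)
  qed
  ultimately show thesis by (rule that)
qed

lemma inner_le_L_const:
  fixes S X :: "'n::{finite,linorder} rmat"
  assumes N: "norm_on sym_mats N" and \<phi>: "symmetric_gauge \<phi>"
    and S: "S \<in> psd_mats \<inter> gauge_ball \<phi>" and X: "X \<in> sym_mats"
  shows "\<bar>S \<bullet> X\<bar> \<le> L_const N \<phi> * N X"
proof -
  obtain K where K: "\<And>S. dual_norm N S \<le> K * norm S"
      "\<And>S X. X \<in> sym_mats \<Longrightarrow> \<bar>S \<bullet> X\<bar> \<le> dual_norm N S * N X"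
    using dual_norm_bounds[OF N] by metis
  obtain b where b: "\<And>S. S \<in> gauge_ball \<phi> \<Longrightarrow> norm S \<le> b"
    using bounded_gauge_ball[OF \<phi>] unfolding bounded_iff by blast
  have "dual_norm N S' \<le> \<bar>K\<bar> * b" if "S' \<in> gauge_ball \<phi>" for S'
  proof -
    have "K * norm S' \<le> \<bar>K\<bar> * norm S'"
      by (intro mult_right_mono) auto
    also have "\<dots> \<le> \<bar>K\<bar> * b"
      using b[OF that] by (intro mult_left_mono) auto
    finally show ?thesis
      using K(1)[of S'] by linarith
  qed
  hence "bdd_above (dual_norm N ` (psd_mats \<inter> gauge_ball \<phi>))"
    by (intro bdd_aboveI2) auto
  hence "dual_norm N S \<le> L_const N \<phi>"
    unfolding L_const_def using S by (intro cSUP_upper)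
  moreover have "N X \<ge> 0"
    using N X unfolding norm_on_def by blast
  ultimately show ?thesis
    using K(2)[OF X, of S] by (meson mult_right_mono order_trans)
qed

text \<open>
  If no element of \<open>A\<close> has trace one, then \<^const>\<open>alpha\<close> is \<open>-\<infinity>\<close>, which \<^const>\<open>real_of_ereal\<close> maps
  to \<open>0\<close>.
\<close>
lemma alpha_nonneg:
  assumes "norm_on sym_mats N" "A \<subseteq> sym_mats"
  shows "0 \<le> real_of_ereal (alpha N A)"
proof (cases "{X \<in> A. trace X = 1} = {}")
  case True
  thus ?thesis
    by (simp only: alpha_def) (simp add: bot_ereal_def)
next
  case False
  then obtain X where X: "X \<in> {X \<in> A. trace X = 1}" by blast
  have "0 \<le> ereal (N X)"
    using assms X by (auto simp: norm_on_def)
  also have "\<dots> \<le> alpha N A"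
    unfolding alpha_def using X by (rule SUP_upper)
  finally show ?thesis
    by (rule real_of_ereal_pos)
qed

text \<open>Every nonzero element of the cone is a positive multiple of one with trace one.\<close>
lemma norm_le_alpha_trace:
  fixes A :: "(real^'n^'n) set"
  assumes N: "norm_on sym_mats N" and A: "A \<subseteq> sym_mats" "cone A"
    and tr: "\<And>X. X \<in> A - {0} \<Longrightarrow> trace X > 0" and fin: "alpha N A < \<infinity>"
    and X: "X \<in> A"
  shows "N X \<le> real_of_ereal (alpha N A) * trace X"
proof (cases "X = 0")
  case True
  have "N 0 = 0"
    using norm_on_zero[OF subspace_sym_mats N] .
  thus ?thesis
    using True by (simp add: trace_def)
next
  case False
  hence pos: "trace X > 0"
    using tr X by blast
  let ?Y = "(1 / trace X) *\<^sub>R X"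
  have YA: "?Y \<in> A"
    using A(2) X pos unfolding cone_def by simp
  have "trace ?Y = 1"
    using pos by (simp add: trace_def sum_divide_distrib[symmetric])
  hence le: "ereal (N ?Y) \<le> alpha N A"
    unfolding alpha_def using YA by (intro SUP_upper) auto
  hence "alpha N A = ereal (real_of_ereal (alpha N A))"
    using fin by (cases "alpha N A") auto
  with le have "N ?Y \<le> real_of_ereal (alpha N A)"
    by (metis ereal_less_eq(3))
  moreover have "N ?Y = \<bar>1 / trace X\<bar> * N X"
    using N X A(1) unfolding norm_on_def by blast
  ultimately show ?thesis
    using pos by (simp add: field_simps)
qed

section \<open>Counting the iterations\<close>

text \<open>
  The support condition on \<open>z i\<close> makes the cut see only the negative eigenvalues, so the value of the
  cut at \<open>X i\<close> is minus the maximum that defines \<open>z i\<close>. The coordinate vector of the least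
  eigenvalue, scaled to gauge one, is a feasible competitor in that maximum. This gives the depth
  \<open>\<epsilon> / \<phi> (axis k 1)\<close> for one particular \<open>k\<close>, and \<open>\<phi>\<close> takes the same value at all canonical basis vectors.
\<close>
lemma scp_cut_depth:
  fixes \<phi> :: "'n::{finite,linorder} rvec \<Rightarrow> real"
  assumes it: "scp_iteration C P A T \<phi> X Q z S i" and \<phi>: "symmetric_gauge \<phi>"
  shows "S i \<in> psd_mats \<inter> gauge_ball \<phi>"
    and "0 < \<epsilon> \<Longrightarrow> lambda_min (X i) \<le> - \<epsilon> \<Longrightarrow> S i \<bullet> X i \<le> - \<epsilon> / \<phi> (axis e 1)"
proof -
  have Q: "orthogonal_matrix (Q i)"
    and XQ: "X i = Q i ** diag (lambda (X i)) ** transpose (Q i)"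
    and SQ: "S i = Q i ** diag (z i) ** transpose (Q i)"
    using it by (auto simp: scp_iteration_def)
  let ?F = "\<lambda>y. (\<forall>j. 0 \<le> y $ j) \<and> \<phi> y \<le> 1 \<and> supp y \<subseteq> supp (lambda_neg (X i))"
  have "is_arg_max (\<lambda>y. lambda_neg (X i) \<bullet> y) ?F (z i)"
    using it by (simp add: scp_iteration_def)
  hence zF: "?F (z i)" and zmax: "\<And>y. ?F y \<Longrightarrow> lambda_neg (X i) \<bullet> y \<le> lambda_neg (X i) \<bullet> z i"
    by (simp_all add: is_arg_max_linorder)
  show "S i \<in> psd_mats \<inter> gauge_ball \<phi>"
    using zF symmetric_gauge_lambda[OF \<phi> Q] psd_orthogonal_conj_diag[of "z i" "Q i"]
      orthogonal_conj_diag_sym[of "Q i" "z i"]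
    by (auto simp: SQ gauge_ball_def)
  assume eps: "0 < \<epsilon>" "lambda_min (X i) \<le> - \<epsilon>"
  define k where "k = (Min UNIV :: 'n)"
  have lk: "lambda (X i) $ k \<le> - \<epsilon>"
    using eps by (simp add: lambda_min_def k_def)
  hence nk: "\<epsilon> \<le> lambda_neg (X i) $ k"
    by (simp add: lambda_neg_def)
  define f where "f = \<phi> (axis k 1)"
  have norm: "norm_on UNIV \<phi>"
    using \<phi> by (simp add: symmetric_gauge_def)
  have "f \<ge> 0" "f \<noteq> 0"
    using norm by (simp_all add: f_def norm_on_def axis_eq_0_iff)
  hence f: "f > 0" by simp
  let ?y = "(1 / f) *\<^sub>R axis k (1::real)"
  have "\<phi> ?y = \<bar>1 / f\<bar> * f"
    using norm unfolding norm_on_def f_def by blast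
  hence "?F ?y"
    using f nk eps(1) by (auto simp: supp_def axis_def)
  hence "lambda_neg (X i) \<bullet> ?y \<le> lambda_neg (X i) \<bullet> z i"
    by (rule zmax)
  moreover have "lambda_neg (X i) \<bullet> ?y = lambda_neg (X i) $ k / f"
    by (simp add: inner_axis)
  moreover have "\<epsilon> / f \<le> lambda_neg (X i) $ k / f"
    using nk f by (simp add: divide_right_mono)
  ultimately have "\<epsilon> / f \<le> lambda_neg (X i) \<bullet> z i" by linarith
  moreover have "S i \<bullet> X i = - (lambda_neg (X i) \<bullet> z i)"
  proof -
    have "S i \<bullet> X i = z i \<bullet> lambda (X i)"
      using inner_orthogonal_conj_diag[OF Q] XQ SQ by metis
    also have "\<dots> = (\<Sum>j\<in>UNIV. - (lambda_neg (X i) $ j * z i $ j))"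
      unfolding inner_vec_def
    proof (rule sum.cong)
      fix j
      show "z i $ j \<bullet> lambda (X i) $ j = - (lambda_neg (X i) $ j * z i $ j)"
      proof (cases "lambda (X i) $ j < 0")
        case False
        hence "lambda_neg (X i) $ j = 0"
          by (simp add: lambda_neg_def)
        moreover from this have "z i $ j = 0"
          using zF by (auto simp: supp_def)
        ultimately show ?thesis by simp
      qed (simp add: lambda_neg_def)
    qed simp
    finally show ?thesis
      by (simp add: inner_vec_def sum_negf)
  qed
  ultimately show "S i \<bullet> X i \<le> - \<epsilon> / \<phi> (axis e 1)"
    using symmetric_gauge_axis[OF \<phi>, of e k] by (simp add: f_def)
qed

text \<open>
  A later iterate satisfies the cut that an earlier one violates by \<open>\<epsilon> / f\<close>, so the two are at
  distance at least \<open>\<delta> = \<epsilon> / (L * f)\<close>, while all of them have norm at most \<open>a * T\<close>; the packing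
  bound applies. The extra one in \<open>Suc M\<close> leaves room for the iteration in which the method stops.
\<close>
lemma nonstopping_iterations_le:
  fixes \<phi> :: "'n::{finite,linorder} rvec \<Rightarrow> real" and e :: 'n
  assumes A: "A \<subseteq> sym_mats" "cone A" and tr: "\<And>X. X \<in> A - {0} \<Longrightarrow> trace X > 0"
    and \<phi>: "symmetric_gauge \<phi>" and N: "norm_on sym_mats N"
    and fin: "alpha N A < \<infinity>" and \<epsilon>: "\<epsilon> > 0" and T: "T > 0"
    and it: "\<And>i. i \<in> {1..M} \<Longrightarrow> scp_iteration C P A T \<phi> X Q z S i"
    and neg: "\<And>i. i \<in> {1..M} \<Longrightarrow> lambda_min (X i) \<le> - \<epsilon>"
  shows "Suc M \<le> iteration_bound N A \<phi> T \<epsilon> e"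
proof (cases "M = 0")
  case True
  thus ?thesis by (simp add: iteration_bound_def)
next
  case False
  define a where "a = real_of_ereal (alpha N A)"
  define L where "L = L_const N \<phi>"
  define f where "f = \<phi> (axis e 1)"
  have X: "X i \<in> master_set P A T S i" if "i \<in> {1..M}" for i
    using it[OF that] by (auto simp: scp_iteration_def is_arg_min_linorder)
  have sym: "X i \<in> sym_mats" if "i \<in> {1..M}" for i
    using X[OF that] by (simp add: master_set_def relaxation_def)
  have a: "a \<ge> 0"
    unfolding a_def using N A(1) by (rule alpha_nonneg)
  have bound: "N (X i) \<le> a * T" if "i \<in> {1..M}" for i
  proof -
    have "X i \<in> A" "trace (X i) \<le> T"
      using X[OF that] by (auto simp: master_set_def relaxation_def)
    thus ?thesis
      using norm_le_alpha_trace[OF N A tr fin, of "X i"] mult_left_mono[OF _ a, of "trace (X i)" T]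
      by (simp add: a_def)
  qed
  have "f \<ge> 0" "f \<noteq> 0"
    using \<phi> by (simp_all add: f_def symmetric_gauge_def norm_on_def axis_eq_0_iff)
  hence f: "f > 0" by simp
  have depth: "S i \<bullet> X i \<le> - \<epsilon> / f" if "i \<in> {1..M}" for i
    unfolding f_def using scp_cut_depth(2)[OF it[OF that] \<phi> \<epsilon> neg[OF that]] .
  have LN: "\<bar>S i \<bullet> Y\<bar> \<le> L * N Y" if "i \<in> {1..M}" "Y \<in> sym_mats" for i Y
    unfolding L_def using inner_le_L_const[OF N \<phi> scp_cut_depth(1)[OF it[OF that(1)] \<phi>] that(2)] .
  \<comment> \<open>A single violated cut forces \<open>L > 0\<close>, so that \<open>\<delta>\<close> below is well defined.\<close>
  have L: "L > 0"
  proof -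
    have 1: "1 \<in> {1..M}" using False by simp
    have "0 < \<epsilon> / f" using \<epsilon> f by simp
    hence "0 < L * N (X 1)"
      using depth[OF 1] LN[OF 1 sym[OF 1]] by (simp add: abs_if split: if_splits)
    moreover have "N (X 1) \<ge> 0"
      using N sym[OF 1] unfolding norm_on_def by blast
    ultimately show ?thesis
      by (simp add: zero_less_mult_iff)
  qed
  define \<delta> where "\<delta> = \<epsilon> / (L * f)"
  have \<delta>: "\<delta> > 0"
    using \<epsilon> L f by (simp add: \<delta>_def)
  have sep_less: "\<delta> \<le> N (X j - X i)" if ij: "i \<in> {1..M}" "j \<in> {1..M}" "i < j" for i j
  proof -
    have "S i \<bullet> X j \<ge> 0"
      using X[OF ij(2)] ij by (simp add: master_set_def)
    hence "\<epsilon> / f \<le> \<bar>S i \<bullet> (X j - X i)\<bar>"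
      using depth[OF ij(1)] by (simp add: inner_diff_right)
    also have "\<dots> \<le> L * N (X j - X i)"
      using LN[OF ij(1)] sym ij by (simp add: subspace_diff[OF subspace_sym_mats])
    finally show ?thesis
      using L f by (simp add: \<delta>_def field_simps)
  qed
  have "real (card {1..M}) \<le> (1 + 2 * (a * T) / \<delta>) ^ dim (sym_mats :: 'n rmat set)"
  proof (rule card_separated_le[OF subspace_sym_mats N, of "{1..M}" X])
    fix i j assume ij: "i \<in> {1..M}" "j \<in> {1..M}" "i \<noteq> j"
    have "N (X i - X j) = N (X j - X i)"
      using norm_on_diff_commute[OF subspace_sym_mats N] sym ij by blast
    thus "\<delta> \<le> N (X i - X j)"
      using sep_less[of i j] sep_less[of j i] ij by (cases i j rule: linorder_cases) auto
  qed (use sym bound a T \<delta> in auto)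
  also have "1 + 2 * (a * T) / \<delta> = 1 + 2 * a * T * L * f / \<epsilon>"
    using \<epsilon> L f by (simp add: \<delta>_def field_simps)
  finally have "real M \<le> (1 + 2 * a * T * L * f / \<epsilon>) ^ dim (sym_mats :: 'n rmat set)"
    by simp
  hence "M \<le> nat \<lceil>(1 + 2 * a * T * L * f / \<epsilon>) ^ dim (sym_mats :: 'n rmat set)\<rceil>"
    by linarith
  thus ?thesis
    by (simp add: iteration_bound_def a_def L_def f_def)
qed

text \<open>
  In a run, if the criterion were met by none of the iterates within the bound, all of them would be
  reached and nonstopping, which is one too many. In a finite execution all iterates except possibly
  the last one fail to meet the criterion.
\<close>
theorem lemma5p1:
  fixes C :: "'n::{finite,linorder} rmat"
    and P A :: "'n rmat set"
    and T \<epsilon> :: real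
    and \<phi> :: "'n rvec \<Rightarrow> real"
    and N :: "'n rmat \<Rightarrow> real"
    and e :: 'n
  assumes "C \<in> sym_mats"
    and "P \<subseteq> sym_mats" and "polyhedron P"
    and "P \<inter> psd_mats \<noteq> {}"
    and "T > 0" and "\<And>X. X \<in> P \<inter> psd_mats \<Longrightarrow> trace X \<le> T"
    and "A \<subseteq> sym_mats" and "closed A" and "convex A" and "cone A"
    and "psd_mats \<subseteq> A" and "\<And>X. X \<in> A - {0} \<Longrightarrow> trace X > 0"
    and "symmetric_gauge \<phi>"
    and "norm_on sym_mats N"
    and "alpha N A < \<infinity>"
    and "\<epsilon> > 0"
  shows "(\<forall>X Q z S. scp_run C P A T \<phi> \<epsilon> X Q z S \<longrightarrow>
            (\<exists>i\<in>{1..iteration_bound N A \<phi> T \<epsilon> e}. lambda_min (X i) > - \<epsilon>)) \<and>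
         (\<forall>X Q z S k. scp_performs C P A T \<phi> \<epsilon> X Q z S k \<longrightarrow>
            k \<le> iteration_bound N A \<phi> T \<epsilon> e)"
proof (intro conjI allI impI)
  fix X Q z S assume run: "scp_run C P A T \<phi> \<epsilon> X Q z S"
  let ?M = "iteration_bound N A \<phi> T \<epsilon> e"
  show "\<exists>i\<in>{1..?M}. lambda_min (X i) > - \<epsilon>"
  proof (rule ccontr)
    assume "\<not> (\<exists>i\<in>{1..?M}. lambda_min (X i) > - \<epsilon>)"
    hence neg: "lambda_min (X i) \<le> - \<epsilon>" if "i \<in> {1..?M}" for i
      using that by (simp add: not_less)
    have it: "scp_iteration C P A T \<phi> X Q z S i" if "i \<in> {1..?M}" for i
      using run neg that by (auto simp: scp_run_def scp_reached_def not_less)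
    have "Suc ?M \<le> ?M"
      by (rule nonstopping_iterations_le) (fact assms it neg)+
    thus False by simp
  qed
next
  fix X Q z S k assume perf: "scp_performs C P A T \<phi> \<epsilon> X Q z S k"
  show "k \<le> iteration_bound N A \<phi> T \<epsilon> e"
  proof (cases k)
    case (Suc m)
    have "scp_reached \<epsilon> X k"
      using perf Suc by (simp add: scp_performs_def)
    hence neg: "lambda_min (X i) \<le> - \<epsilon>" if "i \<in> {1..m}" for i
      using that Suc by (simp add: scp_reached_def not_less)
    have it: "scp_iteration C P A T \<phi> X Q z S i" if "i \<in> {1..m}" for i
      using perf that Suc by (simp add: scp_performs_def)
    show ?thesis
      unfolding Suc by (rule nonstopping_iterations_le) (fact assms it neg)+
  qed simp
qed

end
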